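(* Let $(S,+,0)$ be an inverse monoid such that $x+x^*=x^*+x$ for all $x\in S$ (i.e., $S$ is a Clifford monoid). If $\|\cdot\|$ is a norm on $S$, then the map $d$ defined on $S\times S$ by $$d(x,y)=\|x+y^*\|-\frac{\|x+x^*\|+\|y+y^*\|}{2},$$ for all $x,y\in S$, is a right-subinvariant and skew-convex metric on $S$. Moreover, if $\|\cdot\|$ is cyclically permutable, in the sense that $\|x+y\|=\|y+x\|$ for all $x,y\in S$, then $S$ is a Hausdorff topological inverse semigroup with respect to the topology induced by $d$ (called the norm topology), and a monotone net $(x_n)_n$ in $S$ converges if and only if $\{\|x_n\|\}_n$ is bounded. In addition, if $S$ is Cauchy complete for $d$, then $S$ is conditionally monotone-complete, and the natural partial order $\leqslant_S$ of the inverse semigroup $S$ is compatible with the norm topology. Conversely, if $d$ is a right-subinvariant, skew-convex metric on $S$, then the map $\|\cdot\|$ defined on $S$ by $$\|x\|:=d(x,0)+d(x+x^*,0),$$ for all $x\in S$, is a norm on $S$ such that the metric topology induced by $d$ and the norm topology coincide.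
   Context: Semigroups are written additively but are not assumed commutative. A semigroup $(S,+)$ is inverse if every $x\in S$ has a unique $x^*\in S$ with $x+x^*+x=x$ and $x^*+x+x^*=x^*$. $E(S)$ denotes the set of idempotents ($e+e=e$), which commute with each other. An inverse monoid is an inverse semigroup with an identity element $0$. The natural partial order is: $x\leqslant_S y$ iff $y=x+e$ for some $e\in E(S)$. Write $\delta x:=x+x^*$. A pseudo-norm on an inverse semigroup $S$ is a map $\|\cdot\|:S\to\mathbb{R}_+$ such that for all $x,y,z\in S$: $\|x+y^*\|=\|y+x^*\|$; $\|x+x^*\|\leqslant\|x+y^*\|$; and $\|x+y^*\|+\|z+z^*\|\leqslant\|x+z^*\|+\|z+y^*\|$. On an inverse monoid one requires in addition $\|0\|=0$. For $e\in E(S)$ let $S_e=\{x\in S: x+e=e+x=x\}$. A norm is a pseudo-norm such that, for all $e\in E(S)$ and $x\in S_e$, $\|x\|=\|e\|$ implies $x=e$. The norm topology of a norm $\|\cdot\|$ is the topology induced by the metric $(x,y)\mapsto\|x+y^*\|-\frac{\|\delta x\|+\|\delta y\|}{2}$. A pseudo-metric $d:S\times S\to\mathbb{R}_+$ satisfies $d(x,x)=0$, $d(x,y)=d(y,x)$ and the triangle inequality; it is a metric if $d(x,y)=0$ implies $x=y$. It is right-subinvariant if $d(x+y^*,z+y^* )\leqslant d(x,z)$ for all $x,y,z$. On a Clifford semigroup (an inverse semigroup with $x+x^*=x^*+x$ for all $x$) it is skew-convex if (i) $d(x,y)\geqslant d(\delta x,\delta y)$ for all $x,y$, and (ii) $d(x,z)=d(\delta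 x,\delta y)+d(x+y^*,z+y^* )$ for all $x,y,z$ with $\delta x\leqslant_S\delta y\leqslant_S\delta z$. A topological inverse semigroup is an inverse semigroup with a topology for which $(x,y)\mapsto x+y$ and $x\mapsto x^*$ are continuous. A net in a poset is monotone if it is non-decreasing or non-increasing (here with respect to $\leqslant_S$). The supinf of a monotone net $(x_n)_n$, if it exists, is the supremum of $\{x_n\}_n$ if the net is non-decreasing and the infimum if it is non-increasing. A subset of a poset is bounded if it has both an upper bound and a lower bound. A poset is conditionally monotone-complete if every bounded monotone net has a supinf. A topology and a partial order are compatible if, whenever $x$ is the supinf of a monotone net, the net converges to $x$.
   Formalization: "Converges iff norms bounded" is false as printed. Here "bounded implies converges" assumes S Cauchy complete, and "bounded" means bounded on a tail, or literally bounded if the net is non-decreasing or its index set has a first element. *)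

theory Defs
  imports "HOL-Analysis.Analysis"
begin

section \<open>Inverse semigroups, written additively\<close>

class inverse_semigroup_add = semigroup_add +
  assumes ex1_star: "\<exists>!y. x + y + x = x \<and> y + x + y = y"

class inverse_monoid_add = inverse_semigroup_add + monoid_add

definition star :: "'a::inverse_semigroup_add \<Rightarrow> 'a"  ("(_\<^sup>\<star>)" [1000] 999) where
  "x\<^sup>\<star> = (THE y. x + y + x = x \<and> y + x + y = y)"

definition delta :: "'a::inverse_semigroup_add \<Rightarrow> 'a" where
  "delta x = x + x\<^sup>\<star>"

definition idempotents :: "'a::semigroup_add set" where
  "idempotents = {e. e + e = e}"

text \<open>The order is the reverse of the more common convention: in a monoid,
  \<open>0\<close> is the least idempotent.\<close>

definition nat_le :: "'a::inverse_semigroup_add \<Rightarrow> 'a \<Rightarrow> bool"  (infix "\<le>\<^sub>S" 50) where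
  "x \<le>\<^sub>S y \<longleftrightarrow> (\<exists>e\<in>idempotents. y = x + e)"

definition local_submonoid :: "'a::semigroup_add \<Rightarrow> 'a set" where
  "local_submonoid e = {x. x + e = x \<and> e + x = x}"


section \<open>Norms and metrics\<close>

definition pseudo_norm :: "('a::inverse_semigroup_add \<Rightarrow> real) \<Rightarrow> bool" where
  "pseudo_norm nrm \<longleftrightarrow>
     (\<forall>x. 0 \<le> nrm x) \<and>
     (\<forall>x y. nrm (x + y\<^sup>\<star>) = nrm (y + x\<^sup>\<star>)) \<and>
     (\<forall>x y. nrm (x + x\<^sup>\<star>) \<le> nrm (x + y\<^sup>\<star>)) \<and>
     (\<forall>x y z. nrm (x + y\<^sup>\<star>) + nrm (z + z\<^sup>\<star>) \<le> nrm (x + z\<^sup>\<star>) + nrm (z + y\<^sup>\<star>))"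

definition monoid_pseudo_norm :: "('a::inverse_monoid_add \<Rightarrow> real) \<Rightarrow> bool" where
  "monoid_pseudo_norm nrm \<longleftrightarrow> pseudo_norm nrm \<and> nrm 0 = 0"

definition monoid_norm :: "('a::inverse_monoid_add \<Rightarrow> real) \<Rightarrow> bool" where
  "monoid_norm nrm \<longleftrightarrow>
     monoid_pseudo_norm nrm \<and>
     (\<forall>e\<in>idempotents. \<forall>x\<in>local_submonoid e. nrm x = nrm e \<longrightarrow> x = e)"

definition cyclically_permutable :: "('a::semigroup_add \<Rightarrow> real) \<Rightarrow> bool" where
  "cyclically_permutable nrm \<longleftrightarrow> (\<forall>x y. nrm (x + y) = nrm (y + x))"

definition norm_dist :: "('a::inverse_semigroup_add \<Rightarrow> real) \<Rightarrow> 'a \<Rightarrow> 'a \<Rightarrow> real" where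
  "norm_dist nrm x y = nrm (x + y\<^sup>\<star>) - (nrm (delta x) + nrm (delta y)) / 2"

definition norm_topology :: "('a::inverse_semigroup_add \<Rightarrow> real) \<Rightarrow> 'a topology" where
  "norm_topology nrm = Metric_space.mtopology UNIV (norm_dist nrm)"

definition right_subinvariant :: "('a::inverse_semigroup_add \<Rightarrow> 'a \<Rightarrow> real) \<Rightarrow> bool" where
  "right_subinvariant d \<longleftrightarrow> (\<forall>x y z. d (x + y\<^sup>\<star>) (z + y\<^sup>\<star>) \<le> d x z)"

definition skew_convex :: "('a::inverse_semigroup_add \<Rightarrow> 'a \<Rightarrow> real) \<Rightarrow> bool" where
  "skew_convex d \<longleftrightarrow>
     (\<forall>x y. d (delta x) (delta y) \<le> d x y) \<and>
     (\<forall>x y z. delta x \<le>\<^sub>S delta y \<and> delta y \<le>\<^sub>S delta z \<longrightarrow>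
        d x z = d (delta x) (delta y) + d (x + y\<^sup>\<star>) (z + y\<^sup>\<star>))"

definition topological_inverse_semigroup :: "'a::inverse_semigroup_add topology \<Rightarrow> bool" where
  "topological_inverse_semigroup T \<longleftrightarrow>
     topspace T = UNIV \<and>
     continuous_map (prod_topology T T) T (\<lambda>(x, y). x + y) \<and>
     continuous_map T T star"


section \<open>Nets and order-theoretic notions\<close>

text \<open>A net is a function on a set \<open>D\<close> directed by a preorder \<open>r\<close>; values of the function
  outside \<open>D\<close> are irrelevant.  The order \<open>le\<close> on the range is always a parameter.\<close>

definition directed_set :: "'i set \<Rightarrow> ('i \<Rightarrow> 'i \<Rightarrow> bool) \<Rightarrow> bool" where
  "directed_set D r \<longleftrightarrow>
     D \<noteq> {} \<and> reflp_on D r \<and> transp_on D r \<and> (\<forall>m\<in>D. \<forall>n\<in>D. \<exists>k\<in>D. r m k \<and> r n k)"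

definition net_filter :: "'i set \<Rightarrow> ('i \<Rightarrow> 'i \<Rightarrow> bool) \<Rightarrow> 'i filter" where
  "net_filter D r = (INF m\<in>D. principal {n\<in>D. r m n})"

definition net_limit ::
    "'a topology \<Rightarrow> 'i set \<Rightarrow> ('i \<Rightarrow> 'i \<Rightarrow> bool) \<Rightarrow> ('i \<Rightarrow> 'a) \<Rightarrow> 'a \<Rightarrow> bool" where
  "net_limit T D r x l \<longleftrightarrow> limitin T x l (net_filter D r)"

definition net_converges ::
    "'a topology \<Rightarrow> 'i set \<Rightarrow> ('i \<Rightarrow> 'i \<Rightarrow> bool) \<Rightarrow> ('i \<Rightarrow> 'a) \<Rightarrow> bool" where
  "net_converges T D r x \<longleftrightarrow> (\<exists>l. net_limit T D r x l)"

definition nondecreasing_net ::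
    "('a \<Rightarrow> 'a \<Rightarrow> bool) \<Rightarrow> 'i set \<Rightarrow> ('i \<Rightarrow> 'i \<Rightarrow> bool) \<Rightarrow> ('i \<Rightarrow> 'a) \<Rightarrow> bool" where
  "nondecreasing_net le D r x \<longleftrightarrow>
     directed_set D r \<and> (\<forall>m\<in>D. \<forall>n\<in>D. r m n \<longrightarrow> le (x m) (x n))"

definition nonincreasing_net ::
    "('a \<Rightarrow> 'a \<Rightarrow> bool) \<Rightarrow> 'i set \<Rightarrow> ('i \<Rightarrow> 'i \<Rightarrow> bool) \<Rightarrow> ('i \<Rightarrow> 'a) \<Rightarrow> bool" where
  "nonincreasing_net le D r x \<longleftrightarrow>
     directed_set D r \<and> (\<forall>m\<in>D. \<forall>n\<in>D. r m n \<longrightarrow> le (x n) (x m))"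

definition monotone_net ::
    "('a \<Rightarrow> 'a \<Rightarrow> bool) \<Rightarrow> 'i set \<Rightarrow> ('i \<Rightarrow> 'i \<Rightarrow> bool) \<Rightarrow> ('i \<Rightarrow> 'a) \<Rightarrow> bool" where
  "monotone_net le D r x \<longleftrightarrow> nondecreasing_net le D r x \<or> nonincreasing_net le D r x"

definition is_upper :: "('a \<Rightarrow> 'a \<Rightarrow> bool) \<Rightarrow> 'a set \<Rightarrow> 'a \<Rightarrow> bool" where
  "is_upper le A u \<longleftrightarrow> (\<forall>a\<in>A. le a u)"

definition is_lower :: "('a \<Rightarrow> 'a \<Rightarrow> bool) \<Rightarrow> 'a set \<Rightarrow> 'a \<Rightarrow> bool" where
  "is_lower le A l \<longleftrightarrow> (\<forall>a\<in>A. le l a)"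

definition is_supremum :: "('a \<Rightarrow> 'a \<Rightarrow> bool) \<Rightarrow> 'a set \<Rightarrow> 'a \<Rightarrow> bool" where
  "is_supremum le A s \<longleftrightarrow> is_upper le A s \<and> (\<forall>u. is_upper le A u \<longrightarrow> le s u)"

definition is_infimum :: "('a \<Rightarrow> 'a \<Rightarrow> bool) \<Rightarrow> 'a set \<Rightarrow> 'a \<Rightarrow> bool" where
  "is_infimum le A s \<longleftrightarrow> is_lower le A s \<and> (\<forall>l. is_lower le A l \<longrightarrow> le l s)"

definition is_supinf ::
    "('a \<Rightarrow> 'a \<Rightarrow> bool) \<Rightarrow> 'i set \<Rightarrow> ('i \<Rightarrow> 'i \<Rightarrow> bool) \<Rightarrow> ('i \<Rightarrow> 'a) \<Rightarrow> 'a \<Rightarrow> bool" where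
  "is_supinf le D r x s \<longleftrightarrow>
     (nondecreasing_net le D r x \<and> is_supremum le (x ` D) s) \<or>
     (nonincreasing_net le D r x \<and> is_infimum le (x ` D) s)"

definition order_bounded :: "('a \<Rightarrow> 'a \<Rightarrow> bool) \<Rightarrow> 'a set \<Rightarrow> bool" where
  "order_bounded le A \<longleftrightarrow> (\<exists>u. is_upper le A u) \<and> (\<exists>l. is_lower le A l)"

text \<open>HOL cannot quantify over index types inside a formula, so the type of indices is a
  parameter of the next two notions; a theorem with a free type variable in its place
  covers all directed index sets.\<close>

definition conditionally_monotone_complete :: "'i itself \<Rightarrow> ('a \<Rightarrow> 'a \<Rightarrow> bool) \<Rightarrow> bool" where
  "conditionally_monotone_complete (_ :: 'i itself) le \<longleftrightarrow>
     (\<forall>(D :: 'i set) r x. monotone_net le D r x \<and> order_bounded le (x ` D) \<longrightarrow>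
        (\<exists>s. is_supinf le D r x s))"

definition compatible_topology :: "'i itself \<Rightarrow> 'a topology \<Rightarrow> ('a \<Rightarrow> 'a \<Rightarrow> bool) \<Rightarrow> bool" where
  "compatible_topology (_ :: 'i itself) T le \<longleftrightarrow>
     (\<forall>(D :: 'i set) r x s. monotone_net le D r x \<and> is_supinf le D r x s \<longrightarrow>
        net_limit T D r x s)"

text \<open>Boundedness of a family of reals indexed by a directed set, either literally or in the
  usual sense for nets, i.e. on some tail.\<close>

definition bounded_net :: "'i set \<Rightarrow> ('i \<Rightarrow> real) \<Rightarrow> bool" where
  "bounded_net D f \<longleftrightarrow> bounded (f ` D)"

definition eventually_bounded_net ::
    "'i set \<Rightarrow> ('i \<Rightarrow> 'i \<Rightarrow> bool) \<Rightarrow> ('i \<Rightarrow> real) \<Rightarrow> bool" where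
  "eventually_bounded_net D r f \<longleftrightarrow> (\<exists>m\<in>D. bounded (f ` {n\<in>D. r m n}))"

definition has_first_index :: "'i set \<Rightarrow> ('i \<Rightarrow> 'i \<Rightarrow> bool) \<Rightarrow> bool" where
  "has_first_index D r \<longleftrightarrow> (\<exists>m\<in>D. \<forall>n\<in>D. r m n)"

end

theory Submission
  imports Defs
begin

text \<open>
  For \<open>x \<le>\<^sub>S y\<close> one has \<open>y + x\<^sup>\<star> = delta y\<close>, so the distance is half the increment of
  \<open>\<parallel>delta \<sqdot>\<parallel>\<close>. Hence monotone nets of bounded norm are Cauchy, and since right translations
  are 1-Lipschitz, limits of monotone nets are suprema or infima.

  Conversely, skew-convexity splits \<open>d 0 x\<close> as \<open>h x + d (delta x) x\<close> with \<open>h x = d 0 (delta x)\<close>, so the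
  norm of \<open>x\<close> is \<open>2 h x + d (delta x) x\<close>. Comparing \<open>x\<close> and \<open>y\<close> after moving both to the maximal
  subgroup at \<open>delta x + delta y\<close> expresses the norm of \<open>x + y\<^sup>\<star>\<close> through \<open>h\<close> and \<open>d\<close>, and shows that
  the distance defined by this norm lies between \<open>d\<close> and \<open>3 d\<close>.
\<close>

section \<open>Inverse semigroups\<close>

lemma star_unique:
  fixes x :: "'a::inverse_semigroup_add"
  assumes "x + y + x = x" "y + x + y = y"
  shows "x\<^sup>\<star> = y"
  unfolding star_def using ex1_star[of x] assms by (intro the1_equality) auto

lemma add_star_add [simp]: "x + x\<^sup>\<star> + x = (x :: 'a::inverse_semigroup_add)"
  and star_add_star [simp]: "x\<^sup>\<star> + x + x\<^sup>\<star> = (x :: 'a::inverse_semigroup_add)\<^sup>\<star>"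
  using theI'[OF ex1_star[of x]] unfolding star_def by auto

lemma star_star [simp]: "(x\<^sup>\<star>)\<^sup>\<star> = (x :: 'a::inverse_semigroup_add)"
  by (rule star_unique) auto

lemma star_idempotent: "(e :: 'a::inverse_semigroup_add) \<in> idempotents \<Longrightarrow> e\<^sup>\<star> = e"
  by (rule star_unique) (auto simp: idempotents_def)

text \<open>With \<open>a\<close> the inverse of \<open>e + f\<close>, the element
  \<open>f + a + e\<close> is an inverse of \<open>e + f\<close> as well, so uniqueness gives
  \<open>a = f + a + e\<close>. This forces \<open>a + a = a\<close>, so \<open>a\<close> is its own
  inverse and therefore equal to \<open>e + f\<close>.\<close>

lemma idempotent_add_aux:
  fixes e f :: "'a::inverse_semigroup_add"
  assumes "e \<in> idempotents" "f \<in> idempotents"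
  shows "e + f \<in> idempotents"
proof -
  define a where "a = (e + f)\<^sup>\<star>"
  have e: "e + e = e" "e + (e + z) = e + z" and f: "f + f = f" "f + (f + z) = f + z" for z
    using assms by (auto simp: idempotents_def simp flip: add.assoc)
  have a1: "e + (f + (a + (e + f))) = e + f"
    using add_star_add[of "e + f"] by (simp add: a_def add.assoc)
  have a2: "a + (e + (f + a)) = a"
    using star_add_star[of "e + f"] by (simp add: a_def add.assoc)
  have a2': "a + (e + (f + (a + z))) = a + z" for z
    using a2 by (metis add.assoc)
  have a: "a = f + a + e"
    unfolding a_def
  proof (rule star_unique)
    show "e + f + (f + (e + f)\<^sup>\<star> + e) + (e + f) = e + f"
      using a1 by (simp add: a_def add.assoc e f)
    show "f + (e + f)\<^sup>\<star> + e + (e + f) + (f + (e + f)\<^sup>\<star> + e) = f + (e + f)\<^sup>\<star> + e"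
      using a2' by (simp add: a_def add.assoc e f)
  qed
  have "a + a = (f + a + e) + (f + a + e)"
    by (simp only: a[symmetric])
  also have "\<dots> = f + a + e"
    by (simp add: add.assoc a2')
  finally have "a \<in> idempotents"
    by (simp add: idempotents_def a[symmetric])
  then show ?thesis
    by (metis a_def star_idempotent star_star)
qed

text \<open>Since \<open>e + f\<close> and \<open>f + e\<close> are both idempotent,
  \<open>f + e\<close> is an inverse of \<open>e + f\<close>; but an idempotent is its own
  inverse.\<close>

lemma idempotents_commute:
  fixes e f :: "'a::inverse_semigroup_add"
  assumes ef: "e \<in> idempotents" "f \<in> idempotents"
  shows "e + f = f + e"
proof -
  have e: "e + e = e" "e + (e + z) = e + z" and f: "f + f = f" "f + (f + z) = f + z" for z
    using assms by (auto simp: idempotents_def simp flip: add.assoc)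
  have 1: "e + (f + (e + f)) = e + f" "f + (e + (f + e)) = f + e"
    using idempotent_add_aux[OF ef] idempotent_add_aux[OF ef(2,1)]
    by (auto simp: idempotents_def add.assoc)
  have "(e + f)\<^sup>\<star> = f + e"
    by (rule star_unique) (simp_all add: add.assoc e f 1)
  then show ?thesis
    using star_idempotent[OF idempotent_add_aux[OF ef]] by metis
qed

lemma delta_idempotent [simp]: "delta x \<in> idempotents"
  by (simp add: delta_def idempotents_def flip: add.assoc)

lemma star_add_idempotent: "x\<^sup>\<star> + x \<in> idempotents"
  by (simp add: idempotents_def flip: add.assoc)

lemma delta_of_idempotent: "e \<in> idempotents \<Longrightarrow> delta e = e"
  by (simp add: delta_def star_idempotent) (simp add: idempotents_def)

lemma star_add: "(x + y)\<^sup>\<star> = y\<^sup>\<star> + (x :: 'a::inverse_semigroup_add)\<^sup>\<star>"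
proof (rule star_unique)
  \<comment> \<open>Once the inner idempotents are swapped, both sums regroup into the defining
    identities of the two inverses.\<close>
  have comm: "(y + y\<^sup>\<star>) + (x\<^sup>\<star> + x) = (x\<^sup>\<star> + x) + (y + y\<^sup>\<star>)"
    using idempotents_commute[OF delta_idempotent[of y] star_add_idempotent[of x]]
    by (simp add: delta_def)
  have "x + y + (y\<^sup>\<star> + x\<^sup>\<star>) + (x + y) = x + ((y + y\<^sup>\<star>) + (x\<^sup>\<star> + x)) + y"
    by (simp add: add.assoc)
  also have "\<dots> = (x + x\<^sup>\<star> + x) + (y + y\<^sup>\<star> + y)"
    unfolding comm by (simp only: add.assoc)
  finally show "x + y + (y\<^sup>\<star> + x\<^sup>\<star>) + (x + y) = x + y" by simp
  have "y\<^sup>\<star> + x\<^sup>\<star> + (x + y) + (y\<^sup>\<star> + x\<^sup>\<star>) = y\<^sup>\<star> + ((x\<^sup>\<star> + x) + (y + y\<^sup>\<star>)) + x\<^sup>\<star>"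
    by (simp add: add.assoc)
  also have "\<dots> = (y\<^sup>\<star> + y + y\<^sup>\<star>) + (x\<^sup>\<star> + x + x\<^sup>\<star>)"
    unfolding comm[symmetric] by (simp only: add.assoc)
  finally show "y\<^sup>\<star> + x\<^sup>\<star> + (x + y) + (y\<^sup>\<star> + x\<^sup>\<star>) = y\<^sup>\<star> + x\<^sup>\<star>" by simp
qed

lemma delta_left [simp]: "delta x + x = x"
  by (simp add: delta_def)

lemma delta_delta [simp]: "delta (delta x) = delta x"
  by (simp add: delta_of_idempotent)

lemma star_delta [simp]: "(delta x)\<^sup>\<star> = delta x"
  by (simp add: star_idempotent)

lemma zero_idempotent [simp]: "(0 :: 'a::inverse_monoid_add) \<in> idempotents"
  by (simp add: idempotents_def)

lemma delta_zero [simp]: "delta (0 :: 'a::inverse_monoid_add) = 0"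
  by (simp add: delta_of_idempotent)

lemma star_zero [simp]: "(0 :: 'a::inverse_monoid_add)\<^sup>\<star> = 0"
  by (simp add: star_idempotent)

section \<open>Clifford monoids: central idempotents and the natural order\<close>

locale clifford_monoid =
  fixes S :: "'a::inverse_monoid_add itself"
  assumes clifford: "x + x\<^sup>\<star> = x\<^sup>\<star> + (x :: 'a)"
begin

lemma delta_eq [simp]: "x + x\<^sup>\<star> = delta x" "x\<^sup>\<star> + x = delta (x :: 'a)"
  using clifford[of x] by (simp_all add: delta_def)

lemma delta_right [simp]: "x + delta x = (x :: 'a)"
  by (metis add.assoc add_star_add delta_eq(2))

text \<open>The Clifford identity equates the two idempotents attached to \<open>e + x\<close>,
  which yields \<open>x\<^sup>\<star> + e + x = delta x + e\<close>. Writing \<open>x\<close> as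
  \<open>delta x + x\<close> and expanding \<open>delta x\<close> then carries \<open>e\<close>
  across \<open>x\<close>.\<close>

lemma idempotent_central:
  assumes e: "e \<in> idempotents"
  shows "e + x = x + (e :: 'a)"
proof -
  have ee: "e + e = e"
    using e by (simp add: idempotents_def)
  have comm: "e + delta x = delta x + e"
    using idempotents_commute[OF e delta_idempotent] .
  have "(e + x) + (e + x)\<^sup>\<star> = e + (x + x\<^sup>\<star>) + e"
    by (simp only: star_add star_idempotent[OF e] add.assoc)
  also have "\<dots> = delta x + e"
    by (metis comm ee add.assoc delta_eq(1))
  finally have 1: "(e + x) + (e + x)\<^sup>\<star> = delta x + e" .
  have "(e + x)\<^sup>\<star> + (e + x) = x\<^sup>\<star> + (e + e) + x"
    by (simp only: star_add star_idempotent[OF e] add.assoc)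
  then have 2: "(e + x)\<^sup>\<star> + (e + x) = x\<^sup>\<star> + e + x"
    by (simp add: ee)
  have 3: "x\<^sup>\<star> + e + x = delta x + e"
    using 1 2 clifford[of "e + x"] by metis
  have "e + x = e + delta x + x"
    by (simp add: add.assoc)
  also have "\<dots> = (x + x\<^sup>\<star>) + e + x"
    by (simp only: comm delta_eq)
  also have "\<dots> = x + (x\<^sup>\<star> + e + x)"
    by (simp only: add.assoc)
  also have "\<dots> = x + e"
    unfolding 3 by (simp flip: add.assoc)
  finally show ?thesis .
qed

lemma delta_central: "delta x + y = y + delta (x :: 'a)"
  by (simp add: idempotent_central)

lemma delta_star [simp]: "delta (x\<^sup>\<star>) = delta (x :: 'a)"
  by (simp add: delta_def[of "x\<^sup>\<star>"])

lemma delta_add: "delta (x + y) = delta x + delta (y :: 'a)"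
proof -
  have "delta (x + y) = x + (y + y\<^sup>\<star>) + x\<^sup>\<star>"
    by (simp only: delta_def star_add add.assoc)
  also have "\<dots> = (x + x\<^sup>\<star>) + delta y"
    by (metis delta_eq(1) add.assoc delta_central)
  finally show ?thesis by simp
qed

lemma delta_idem [simp]: "delta x + delta x = delta (x :: 'a)"
  using delta_idempotent by (simp add: idempotents_def)

lemma delta_left_idem [simp]: "delta x + (delta x + y) = delta x + (y :: 'a)"
  by (metis add.assoc delta_idem)

text \<open>If \<open>y = x + e\<close>, then \<open>delta y = delta x + e\<close>, and
  \<open>x\<close> absorbs \<open>delta x\<close>; so \<open>delta y\<close> can serve as the
  witness. The order becomes an equation, a form that can be passed to limits of nets.\<close>

lemma nat_le_iff: "x \<le>\<^sub>S y \<longleftrightarrow> y = x + delta (y :: 'a)"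
proof
  assume "x \<le>\<^sub>S y"
  then obtain e where e: "e \<in> idempotents" "y = x + e"
    by (auto simp: nat_le_def)
  then have "x + delta y = x + delta x + e"
    by (simp add: delta_add delta_of_idempotent flip: add.assoc)
  then show "y = x + delta y"
    using e by simp
qed (use delta_idempotent nat_le_def in blast)

lemma nat_le_delta: "x \<le>\<^sub>S y \<Longrightarrow> delta y = delta x + delta (y :: 'a)"
  unfolding nat_le_iff by (metis delta_add delta_delta)

lemma nat_le_delta_iff: "delta x \<le>\<^sub>S delta y \<longleftrightarrow> delta y = delta x + delta (y :: 'a)"
  by (simp add: nat_le_iff)

lemma nat_le_antisym: "x \<le>\<^sub>S y \<Longrightarrow> y \<le>\<^sub>S x \<Longrightarrow> x = (y :: 'a)"
  unfolding nat_le_iff by (metis add.assoc delta_central delta_right)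

end

section \<open>Nets\<close>

lemma directed_set_upper:
  "directed_set D r \<Longrightarrow> m \<in> D \<Longrightarrow> n \<in> D \<Longrightarrow> \<exists>k\<in>D. r m k \<and> r n k"
  by (simp add: directed_set_def)

lemma directed_set_trans:
  "directed_set D r \<Longrightarrow> m \<in> D \<Longrightarrow> n \<in> D \<Longrightarrow> k \<in> D \<Longrightarrow> r m n \<Longrightarrow> r n k \<Longrightarrow> r m k"
  unfolding directed_set_def by (meson transp_onD)

text \<open>Directedness makes the tails a filter base, so the infimum of their principal filters is
  tested on a single tail.\<close>

lemma eventually_net_filter:
  assumes D: "directed_set D r"
  shows "eventually P (net_filter D r) \<longleftrightarrow> (\<exists>m\<in>D. \<forall>n\<in>D. r m n \<longrightarrow> P n)"
proof -
  have "eventually P (net_filter D r) \<longleftrightarrow> (\<exists>m\<in>D. eventually P (principal {n\<in>D. r m n}))"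
    unfolding net_filter_def
  proof (rule eventually_INF_base)
    show "D \<noteq> {}"
      using D by (simp add: directed_set_def)
    fix m n assume mn: "m \<in> D" "n \<in> D"
    then obtain k where k: "k \<in> D" "r m k" "r n k"
      using directed_set_upper[OF D] by blast
    then have "{i\<in>D. r k i} \<subseteq> {i\<in>D. r m i} \<inter> {i\<in>D. r n i}"
      using directed_set_trans[OF D] mn by blast
    with k show "\<exists>k\<in>D. principal {i\<in>D. r k i} \<le> inf (principal {i\<in>D. r m i}) (principal {i\<in>D. r n i})"
      by (auto simp: inf_principal)
  qed
  then show ?thesis
    by (auto simp: eventually_principal)
qed

section \<open>Nets in metric spaces\<close>

context Metric_space
begin

lemma net_limit_iff:
  assumes "directed_set D r"
  shows "net_limit mtopology D r x l \<longleftrightarrow>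
    l \<in> M \<and> (\<forall>\<epsilon>>0. \<exists>m\<in>D. \<forall>n\<in>D. r m n \<longrightarrow> x n \<in> M \<and> d (x n) l < \<epsilon>)"
  unfolding net_limit_def limitin_metric eventually_net_filter[OF assms] ..

text \<open>The device by which order relations pass to limits: \<open>a\<close> and
  \<open>b\<close> stay fixed while \<open>x n\<close> approaches \<open>l\<close>. The factor 2
  leaves room for a detour through \<open>x n\<close>.\<close>

lemma net_limit_eqI:
  assumes D: "directed_set D r" and lim: "net_limit mtopology D r x l"
    and ab: "a \<in> M" "b \<in> M"
    and "m \<in> D" and le: "\<And>n. n \<in> D \<Longrightarrow> r m n \<Longrightarrow> d a b \<le> 2 * d (x n) l"
  shows "a = b"
proof (rule ccontr)
  assume "a \<noteq> b"
  then have "d a b / 2 > 0"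
    using ab by simp
  then obtain k where k: "k \<in> D" "\<forall>n\<in>D. r k n \<longrightarrow> d (x n) l < d a b / 2"
    using lim unfolding net_limit_iff[OF D] by blast
  obtain n where "n \<in> D" "r m n" "r k n"
    using directed_set_upper[OF D \<open>m \<in> D\<close> k(1)] by blast
  then show False
    using le[of n] k(2) by force
qed

text \<open>Beyond an index where \<open>g\<close> is close to its supremum, little variation
  remains, so the net is Cauchy. As \<open>mcomplete\<close> speaks of sequences, a limit is first
  found along a sequence of indices and then transferred to the net.\<close>

lemma monotone_potential_net_converges:
  fixes g :: "'i \<Rightarrow> real"
  assumes complete: mcomplete and D: "directed_set D r"
    and M: "\<And>n. n \<in> D \<Longrightarrow> x n \<in> M"
    and g: "\<And>m n. m \<in> D \<Longrightarrow> n \<in> D \<Longrightarrow> r m n \<Longrightarrow> d (x m) (x n) \<le> g n - g m"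
    and bdd: "bdd_above (g ` D)"
  shows "net_converges mtopology D r x"
proof -
  define c where "c = Sup (g ` D)"
  have le_c: "g n \<le> c" if "n \<in> D" for n
    unfolding c_def using bdd that by (simp add: cSup_upper)
  have "\<exists>m\<in>D. c - inverse (real (Suc k)) < g m" for k
  proof -
    have "D \<noteq> {}"
      using D by (simp add: directed_set_def)
    then have "\<exists>y\<in>g ` D. c - inverse (real (Suc k)) < y"
      unfolding c_def using bdd by (subst less_cSup_iff[symmetric]) auto
    then show ?thesis by blast
  qed
  then obtain i where i: "\<And>k. i k \<in> D" "\<And>k. c - inverse (real (Suc k)) < g (i k)"
    by metis
  have tail: "d (x (i k)) (x n) < inverse (real (Suc k))" if "n \<in> D" "r (i k) n" for k n
    using g[OF i(1) that] le_c[OF that(1)] i(2)[of k] by linarith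
  \<comment> \<open>The indices \<open>i k\<close> need not increase along \<open>r\<close>, so two
    of them are compared through a common upper bound \<open>p\<close>.\<close>
  have bound: "d (x (i k)) (x (i l)) < inverse (real (Suc k)) + inverse (real (Suc l))" for k l
  proof -
    obtain p where p: "p \<in> D" "r (i k) p" "r (i l) p"
      using directed_set_upper[OF D i(1) i(1)] by blast
    have "d (x (i k)) (x (i l)) \<le> d (x (i k)) (x p) + d (x (i l)) (x p)"
      using triangle' M i(1) p(1) by metis
    then show ?thesis
      using tail[OF p(1,2)] tail[OF p(1,3)] by linarith
  qed
  have small: "\<exists>K. \<forall>k\<ge>K. inverse (real (Suc k)) < \<epsilon> / 2" if "\<epsilon> > 0" for \<epsilon>
    using order_tendstoD(2)[OF LIMSEQ_inverse_real_of_nat, of "\<epsilon> / 2"] that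
    by (simp add: eventually_sequentially)
  have "MCauchy (x \<circ> i)"
    unfolding MCauchy_def
  proof (intro conjI allI impI)
    show "range (x \<circ> i) \<subseteq> M"
      using M i(1) by auto
    fix \<epsilon> :: real assume "\<epsilon> > 0"
    then obtain K where "\<forall>k\<ge>K. inverse (real (Suc k)) < \<epsilon> / 2"
      using small by blast
    then have "\<forall>k l. K \<le> k \<longrightarrow> K \<le> l \<longrightarrow> d ((x \<circ> i) k) ((x \<circ> i) l) < \<epsilon>"
      using bound by (smt (verit) comp_apply field_sum_of_halves)
    then show "\<exists>K. \<forall>k l. K \<le> k \<longrightarrow> K \<le> l \<longrightarrow> d ((x \<circ> i) k) ((x \<circ> i) l) < \<epsilon>" ..
  qed
  then obtain l where l: "limitin mtopology (x \<circ> i) l sequentially"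
    using complete unfolding mcomplete_def by blast
  then have "l \<in> M"
    by (simp add: limit_metric_sequentially)
  have "net_limit mtopology D r x l"
    unfolding net_limit_iff[OF D]
  proof (intro conjI allI impI)
    fix \<epsilon> :: real assume "\<epsilon> > 0"
    then obtain K where K: "\<forall>k\<ge>K. inverse (real (Suc k)) < \<epsilon> / 2"
      using small by blast
    have "\<epsilon> / 2 > 0"
      using \<open>\<epsilon> > 0\<close> by simp
    then obtain L where L: "\<forall>k\<ge>L. d (x (i k)) l < \<epsilon> / 2"
      using l unfolding limit_metric_sequentially comp_apply by blast
    \<comment> \<open>The bound by \<open>K\<close> keeps the tail close to \<open>x (i k)\<close>,
      the bound by \<open>L\<close> keeps \<open>x (i k)\<close> close to \<open>l\<close>.\<close>
    define k where "k = max K L"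
    have "x n \<in> M \<and> d (x n) l < \<epsilon>" if n: "n \<in> D" "r (i k) n" for n
    proof -
      have "d (x n) l \<le> d (x (i k)) (x n) + d (x (i k)) l"
        using triangle'' M i(1) n(1) \<open>l \<in> M\<close> by metis
      moreover have "inverse (real (Suc k)) < \<epsilon> / 2" "d (x (i k)) l < \<epsilon> / 2"
        using K L by (simp_all add: k_def)
      ultimately show ?thesis
        using tail[OF n] M[OF n(1)] by linarith
    qed
    then show "\<exists>m\<in>D. \<forall>n\<in>D. r m n \<longrightarrow> x n \<in> M \<and> d (x n) l < \<epsilon>"
      using i(1) by blast
  qed fact
  then show ?thesis
    unfolding net_converges_def ..
qed

end

section \<open>The metric of a norm\<close>

locale clifford_norm = clifford_monoid S for S :: "'a::inverse_monoid_add itself" +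
  fixes N :: "'a \<Rightarrow> real"
  assumes norm: "monoid_norm N"
begin

lemma norm_nonneg [simp]: "0 \<le> N x"
  and norm_commute: "N (x + y\<^sup>\<star>) = N (y + x\<^sup>\<star>)"
  and norm_delta_le_add_star: "N (delta x) \<le> N (x + y\<^sup>\<star>)"
  and norm_triangle: "N (x + y\<^sup>\<star>) + N (delta z) \<le> N (x + z\<^sup>\<star>) + N (z + y\<^sup>\<star>)"
  and norm_zero [simp]: "N 0 = 0"
  using norm by (auto simp: monoid_norm_def monoid_pseudo_norm_def pseudo_norm_def)

lemma norm_eq_idempotentD:
  assumes "e \<in> idempotents" "x + e = x" "N x = N e"
  shows "x = e"
  using norm assms idempotent_central[OF assms(1), of x]
  by (auto simp: monoid_norm_def local_submonoid_def)

lemma norm_delta_le: "N (delta x) \<le> N x"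
  using norm_delta_le_add_star[of x 0] by simp

text \<open>The triangle inequality through the idempotent itself.\<close>

lemma norm_add_idempotent: "e \<in> idempotents \<Longrightarrow> N x \<le> N (x + e)"
  using norm_triangle[of x 0 e] by (simp add: star_idempotent delta_of_idempotent)

lemma norm_mono: "x \<le>\<^sub>S y \<Longrightarrow> N x \<le> N y"
  by (auto simp: nat_le_def norm_add_idempotent)

lemma norm_delta_mono: "x \<le>\<^sub>S y \<Longrightarrow> N (delta x) \<le> N (delta y)"
  by (metis nat_le_delta nat_le_delta_iff norm_mono)

section \<open>The metric axioms\<close>

lemma norm_dist_commute: "norm_dist N x y = norm_dist N y x"
  by (simp add: norm_dist_def norm_commute[of x y])

text \<open>\<open>N (x + y\<^sup>\<star>)\<close> dominates both \<open>N (delta x)\<close> and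
  \<open>N (delta y)\<close>, so being their mean it equals both, and the norm of
  \<open>delta x + delta y\<close> is squeezed to the same value. Definiteness of the norm then
  applies three times: \<open>?e\<close> equals \<open>delta x\<close>, equals
  \<open>delta y\<close>, and equals \<open>x + y\<^sup>\<star>\<close>.\<close>

lemma norm_dist_eq_0D:
  assumes "norm_dist N x y = 0"
  shows "x = y"
proof -
  have eq: "N (x + y\<^sup>\<star>) = N (delta x)" "N (x + y\<^sup>\<star>) = N (delta y)"
    using assms norm_delta_le_add_star[of x y] norm_delta_le_add_star[of y x] norm_commute[of x y]
    by (simp_all add: norm_dist_def)
  let ?e = "delta x + delta y"
  have "N ?e \<le> N (x + y\<^sup>\<star>)"
    using norm_delta_le[of "x + y\<^sup>\<star>"] by (simp add: delta_add)
  moreover have "N (delta x) \<le> N ?e"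
    by (simp add: norm_add_idempotent)
  ultimately have e: "N ?e = N (delta x)" "N ?e = N (delta y)" "N (x + y\<^sup>\<star>) = N ?e"
    using eq by linarith+
  have e_idem: "?e \<in> idempotents"
    by (metis delta_add delta_idempotent)
  have x: "?e = delta x"
    by (rule norm_eq_idempotentD[OF _ _ e(1)]) (simp, metis add.assoc delta_central delta_idem)
  have y: "?e = delta y"
    by (rule norm_eq_idempotentD[OF _ _ e(2)]) (simp, simp add: add.assoc)
  have "x + y\<^sup>\<star> = ?e"
  proof (rule norm_eq_idempotentD[OF e_idem _ e(3)])
    show "x + y\<^sup>\<star> + ?e = x + y\<^sup>\<star>"
      by (metis delta_add delta_right delta_star)
  qed
  then have "x + y\<^sup>\<star> + y = ?e + y"
    by simp
  then have "x + delta y = delta y + y"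
    using y by (simp add: add.assoc)
  then show ?thesis
    using x y by (metis delta_left delta_right)
qed

sublocale Metric_space UNIV "norm_dist N"
proof
  fix x y z :: 'a
  show "0 \<le> norm_dist N x y"
    using norm_delta_le_add_star[of x y] norm_delta_le_add_star[of y x] norm_commute[of x y]
    by (simp add: norm_dist_def)
  show "norm_dist N x y = norm_dist N y x"
    by (rule norm_dist_commute)
  show "norm_dist N x y = 0 \<longleftrightarrow> x = y"
    using norm_dist_eq_0D by (auto simp: norm_dist_def)
  \<comment> \<open>The two halves of \<open>N (delta y)\<close> at the middle point add up to the
    extra term in the norm axiom.\<close>
  show "norm_dist N x z \<le> norm_dist N x y + norm_dist N y z"
    using norm_triangle[of x z y] by (simp add: norm_dist_def field_simps)
qed

section \<open>Right translations and skew-convexity\<close>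

lemma add_star_right_translate: "(x + y) + (z + y)\<^sup>\<star> = x + z\<^sup>\<star> + delta (y :: 'a)"
  by (metis add.assoc delta_central delta_eq(1) star_add)

text \<open>Translation by \<open>y\<close> changes \<open>x + z\<^sup>\<star>\<close> only by the
  central idempotent \<open>delta y\<close>. The resulting increase of the norm is bounded by that
  of \<open>N (delta x)\<close> and also by that of \<open>N (delta z)\<close>, hence by their mean,
  which is exactly what the subtracted terms compensate.\<close>

lemma norm_dist_add_right: "norm_dist N (x + y) (z + y) \<le> norm_dist N x z"
proof -
  \<comment> \<open>This is the norm axiom for \<open>x + delta y\<close> and \<open>z\<close> with
    \<open>x\<close> as the middle point.\<close>
  have half: "N (x + z\<^sup>\<star> + delta y) + N (delta x) \<le> N (delta x + delta y) + N (x + z\<^sup>\<star>)" for x z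
  proof -
    have "x + delta y + w\<^sup>\<star> = x + w\<^sup>\<star> + delta y" for w
      by (simp add: add.assoc delta_central)
    then show ?thesis
      using norm_triangle[of "x + delta y" z x] delta_central[of x "delta y"] by simp
  qed
  have "N (z + x\<^sup>\<star> + delta y) = N (x + z\<^sup>\<star> + delta y)"
    using norm_commute[of "x + y" "z + y"] by (simp add: add_star_right_translate)
  then show ?thesis
    using half[of x z] half[of z x] norm_commute[of x z]
    by (simp add: norm_dist_def add_star_right_translate delta_add add_divide_distrib)
qed

lemma norm_dist_delta: "norm_dist N (delta x) (delta y) \<le> norm_dist N x y"
  using norm_delta_le[of "x + y\<^sup>\<star>"] by (simp add: norm_dist_def delta_add)

lemma right_subinvariant_norm_dist: "right_subinvariant (norm_dist N)"
  by (simp add: right_subinvariant_def norm_dist_add_right)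

lemma skew_convex_norm_dist: "skew_convex (norm_dist N)"
  unfolding skew_convex_def
proof (intro conjI allI impI norm_dist_delta)
  fix x y z :: 'a
  assume "delta x \<le>\<^sub>S delta y \<and> delta y \<le>\<^sub>S delta z"
  then have xy: "delta x + delta y = delta y" and yz: "delta y + delta z = delta z"
    by (simp_all add: nat_le_delta_iff)
  \<comment> \<open>Because \<open>delta y\<close> lies below \<open>delta z\<close>, the
    translation leaves \<open>x + z\<^sup>\<star>\<close> unchanged; what remains is a telescoping
    of the halved norms of idempotents.\<close>
  have "z\<^sup>\<star> + delta y = z\<^sup>\<star>"
    by (metis add.assoc delta_central delta_right delta_star yz)
  then have "x + z\<^sup>\<star> + delta y = x + z\<^sup>\<star>"
    by (simp add: add.assoc)
  then show "norm_dist N x z =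
      norm_dist N (delta x) (delta y) + norm_dist N (x + y\<^sup>\<star>) (z + y\<^sup>\<star>)"
    using yz delta_central[of z "delta y"]
    by (simp add: norm_dist_def add_star_right_translate delta_add xy yz add_divide_distrib)
qed

subsection \<open>The inverse semigroup topology\<close>

text \<open>Right translations contract by themselves. Cyclic permutability brings \<open>x'\<close>
  next to its inverse and so turns left translation by \<open>x'\<close> into right translation by
  \<open>x'\<close>; the path through \<open>x' + y\<close> then has two contracted legs.\<close>

lemma norm_dist_add:
  assumes "cyclically_permutable N"
  shows "norm_dist N (x + y) (x' + y') \<le> norm_dist N x x' + norm_dist N y y'"
proof -
  have "N (x' + y + (x' + y')\<^sup>\<star>) = N (y + x' + (y' + x')\<^sup>\<star>)"
  proof -
    have "N (x' + y + (x' + y')\<^sup>\<star>) = N (x' + (y + y'\<^sup>\<star> + x'\<^sup>\<star>))"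
      by (simp add: star_add add.assoc)
    also have "\<dots> = N ((y + y'\<^sup>\<star> + x'\<^sup>\<star>) + x')"
      using assms unfolding cyclically_permutable_def by blast
    finally show ?thesis
      by (simp add: add_star_right_translate) (simp add: add.assoc)
  qed
  then have "norm_dist N (x' + y) (x' + y') = norm_dist N (y + x') (y' + x')"
    by (simp add: norm_dist_def delta_add delta_central[of x'])
  then show ?thesis
    using triangle[of "x + y" "x' + y" "x' + y'"] norm_dist_add_right[of x y x']
      norm_dist_add_right[of y x' y'] by simp
qed

lemma norm_dist_star:
  assumes "cyclically_permutable N"
  shows "norm_dist N (x\<^sup>\<star>) (y\<^sup>\<star>) = norm_dist N x y"
proof -
  have "N (x\<^sup>\<star> + y) = N (x + y\<^sup>\<star>)"
    using assms norm_commute[of x y] by (simp add: cyclically_permutable_def)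
  then show ?thesis
    by (simp add: norm_dist_def)
qed

lemma topological_inverse_semigroup_norm:
  assumes cyc: "cyclically_permutable N"
  shows "topological_inverse_semigroup mtopology"
  unfolding topological_inverse_semigroup_def
proof (intro conjI)
  show "continuous_map (prod_topology mtopology mtopology) mtopology (\<lambda>(x, y). x + y)"
    unfolding continuous_map_to_metric
  proof (intro ballI allI impI)
    fix p :: "'a \<times> 'a" and \<epsilon> :: real
    assume "\<epsilon> > 0"
    obtain x y where p: "p = (x, y)" by fastforce
    define U where "U = mball x (\<epsilon> / 2) \<times> mball y (\<epsilon> / 2)"
    have "openin (prod_topology mtopology mtopology) U"
      by (simp add: U_def openin_prod_Times_iff)
    moreover have "p \<in> U"
      using \<open>\<epsilon> > 0\<close> by (simp add: U_def p)
    moreover have "x' + y' \<in> mball (x + y) \<epsilon>" if "(x', y') \<in> U" for x' y'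
      using norm_dist_add[OF cyc, of x y x' y'] that by (simp add: U_def)
    ultimately show "\<exists>U. openin (prod_topology mtopology mtopology) U \<and> p \<in> U \<and>
        (\<forall>q\<in>U. (case q of (x, y) \<Rightarrow> x + y) \<in> mball (case p of (x, y) \<Rightarrow> x + y) \<epsilon>)"
      unfolding p by (intro exI[of _ U]) force
  qed
  show "continuous_map mtopology mtopology (star :: 'a \<Rightarrow> 'a)"
    unfolding continuous_map_to_metric
  proof (intro ballI allI impI)
    fix x :: 'a and \<epsilon> :: real
    assume "\<epsilon> > 0"
    then show "\<exists>U. openin mtopology U \<and> x \<in> U \<and> (\<forall>y\<in>U. y\<^sup>\<star> \<in> mball (x\<^sup>\<star>) \<epsilon>)"
      by (intro exI[of _ "mball x \<epsilon>"]) (simp add: norm_dist_star[OF cyc])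
  qed
qed simp

subsection \<open>Monotone nets\<close>

lemma norm_dist_nat_le:
  assumes "x \<le>\<^sub>S y"
  shows "norm_dist N x y = (N (delta y) - N (delta x)) / 2"
proof -
  have "y + x\<^sup>\<star> = delta y"
    using assms nat_le_delta[OF assms] delta_central[of y]
    by (metis add.assoc delta_eq(1) nat_le_iff)
  then show ?thesis
    using norm_commute[of x y] by (simp add: norm_dist_def field_simps)
qed

text \<open>Both halves of the supremum property are equations by \<open>nat_le_iff\<close>. Each
  holds at \<open>x n\<close> for large \<open>n\<close>, and contraction under right translation
  and under \<open>delta\<close> makes the error at \<open>l\<close> comparable to the distance from
  \<open>x n\<close> to \<open>l\<close>.\<close>

lemma nondecreasing_net_limit_supremum:
  assumes net: "nondecreasing_net (\<le>\<^sub>S) D r x" and lim: "net_limit mtopology D r x l"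
  shows "is_supremum (\<le>\<^sub>S) (x ` D) l"
proof -
  have D: "directed_set D r" and mono: "\<And>m n. m \<in> D \<Longrightarrow> n \<in> D \<Longrightarrow> r m n \<Longrightarrow> x m \<le>\<^sub>S x n"
    using net by (auto simp: nondecreasing_net_def)
  have "x m \<le>\<^sub>S l" if m: "m \<in> D" for m
    unfolding nat_le_iff
  proof (rule net_limit_eqI[OF D lim _ _ m])
    fix n assume n: "n \<in> D" "r m n"
    \<comment> \<open>The varying idempotent is put on the left so that \<open>x m\<close> acts as a
      right translation of \<open>delta (x n)\<close> and \<open>delta l\<close>.\<close>
    have xn: "x n = delta (x n) + x m"
      using mono[OF m n] by (simp add: nat_le_iff delta_central)
    have "norm_dist N (x n) (x m + delta l) = norm_dist N (delta (x n) + x m) (delta l + x m)"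
      using xn by (metis delta_central)
    then show "norm_dist N l (x m + delta l) \<le> 2 * norm_dist N (x n) l"
      using triangle''[of l "x n" "x m + delta l"]
          norm_dist_add_right[of "delta (x n)" "x m" "delta l"] norm_dist_delta[of "x n" l]
      by simp
  qed simp_all
  moreover have "l \<le>\<^sub>S u" if u: "is_upper (\<le>\<^sub>S) (x ` D) u" for u
  proof -
    obtain m where m: "m \<in> D"
      using D by (auto simp: directed_set_def)
    show ?thesis
      unfolding nat_le_iff
    proof (rule net_limit_eqI[OF D lim _ _ m])
      fix n assume "n \<in> D"
      \<comment> \<open>Right translation by \<open>delta u\<close> sends \<open>x n\<close> to
        \<open>u\<close> and \<open>l\<close> to \<open>l + delta u\<close>, so a single contraction
        suffices.\<close>
      then have "u = x n + delta u"
        using u by (auto simp: is_upper_def nat_le_iff)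
      then show "norm_dist N u (l + delta u) \<le> 2 * norm_dist N (x n) l"
        using norm_dist_add_right[of "x n" "delta u" l] nonneg[of "x n" l]
        by (metis add_increasing2 mult_2)
    qed simp_all
  qed
  ultimately show ?thesis
    by (simp add: is_supremum_def is_upper_def)
qed

text \<open>The two estimates for suprema exchange roles: translation by \<open>delta (x m)\<close>
  shows that \<open>l\<close> is a lower bound, and translation by \<open>v\<close> together with
  contraction under \<open>delta\<close> shows that it is the greatest one.\<close>

lemma nonincreasing_net_limit_infimum:
  assumes net: "nonincreasing_net (\<le>\<^sub>S) D r x" and lim: "net_limit mtopology D r x l"
  shows "is_infimum (\<le>\<^sub>S) (x ` D) l"
proof -
  have D: "directed_set D r" and mono: "\<And>m n. m \<in> D \<Longrightarrow> n \<in> D \<Longrightarrow> r m n \<Longrightarrow> x n \<le>\<^sub>S x m"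
    using net by (auto simp: nonincreasing_net_def)
  have "l \<le>\<^sub>S x m" if m: "m \<in> D" for m
    unfolding nat_le_iff
  proof (rule net_limit_eqI[OF D lim _ _ m])
    fix n assume n: "n \<in> D" "r m n"
    have "x m = x n + delta (x m)"
      using mono[OF m n] by (simp add: nat_le_iff)
    then show "norm_dist N (x m) (l + delta (x m)) \<le> 2 * norm_dist N (x n) l"
      using norm_dist_add_right[of "x n" "delta (x m)" l] nonneg[of "x n" l]
      by (metis add_increasing2 mult_2)
  qed simp_all
  moreover have "v \<le>\<^sub>S l" if v: "is_lower (\<le>\<^sub>S) (x ` D) v" for v
  proof -
    obtain m where m: "m \<in> D"
      using D by (auto simp: directed_set_def)
    show ?thesis
      unfolding nat_le_iff
    proof (rule net_limit_eqI[OF D lim _ _ m])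
      fix n assume "n \<in> D"
      then have xn: "x n = delta (x n) + v"
        using v by (auto simp: is_lower_def nat_le_iff delta_central)
      have "norm_dist N (x n) (v + delta l) = norm_dist N (delta (x n) + v) (delta l + v)"
        using xn by (metis delta_central)
      then show "norm_dist N l (v + delta l) \<le> 2 * norm_dist N (x n) l"
        using triangle''[of l "x n" "v + delta l"]
          norm_dist_add_right[of "delta (x n)" v "delta l"] norm_dist_delta[of "x n" l]
        by simp
    qed simp_all
  qed
  ultimately show ?thesis
    by (simp add: is_infimum_def is_lower_def)
qed

section \<open>Boundedness of norms along nets\<close>

lemma norm_le_dist_zero: "N x \<le> 2 * norm_dist N x 0"
  \<comment> \<open>The distance to 0 is \<open>N x - N (delta x) / 2\<close>, at least half of
    \<open>N x\<close>.\<close>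
  using norm_delta_le[of x] by (simp add: norm_dist_def)

lemma convergent_net_eventually_bounded:
  assumes D: "directed_set D r" and "net_converges mtopology D r x"
  shows "eventually_bounded_net D r (\<lambda>n. N (x n))"
proof -
  obtain l where "net_limit mtopology D r x l"
    using assms(2) by (auto simp: net_converges_def)
  then obtain m where m: "m \<in> D" "\<forall>n\<in>D. r m n \<longrightarrow> norm_dist N (x n) l < 1"
    unfolding net_limit_iff[OF D] by (meson zero_less_one)
  have "norm (N (x n)) \<le> 2 * (1 + norm_dist N l 0)" if "n \<in> D" "r m n" for n
    using m(2) that norm_le_dist_zero[of "x n"] triangle[of "x n" l 0] by fastforce
  then show ?thesis
    using m(1) unfolding eventually_bounded_net_def bounded_iff by blast
qed

text \<open>Every index has a successor in the bounded tail, and norms only increase on the way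
  there.\<close>

lemma nondecreasing_net_bounded:
  assumes net: "nondecreasing_net (\<le>\<^sub>S) D r x"
    and "eventually_bounded_net D r (\<lambda>n. N (x n))"
  shows "bounded_net D (\<lambda>n. N (x n))"
proof -
  obtain m C where m: "m \<in> D" "\<And>n. n \<in> D \<Longrightarrow> r m n \<Longrightarrow> N (x n) \<le> C"
    using assms(2) unfolding eventually_bounded_net_def bounded_iff by fastforce
  have "norm (N (x n)) \<le> C" if n: "n \<in> D" for n
  proof -
    obtain k where k: "k \<in> D" "r m k" "r n k"
      using directed_set_upper[of D r m n] net m(1) n by (auto simp: nondecreasing_net_def)
    then have "N (x n) \<le> N (x k)"
      using net n by (simp add: nondecreasing_net_def norm_mono)
    then show ?thesis
      using m(2)[OF k(1,2)] by simp
  qed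
  then show ?thesis
    unfolding bounded_net_def bounded_iff by blast
qed

lemma nonincreasing_net_bounded:
  assumes "nonincreasing_net (\<le>\<^sub>S) D r x" "m \<in> D"
  shows "bounded ((\<lambda>n. N (x n)) ` {n\<in>D. r m n})"
  using assms unfolding bounded_iff nonincreasing_net_def
  by (intro exI[of _ "N (x m)"]) (auto simp: norm_mono)

section \<open>Convergence of monotone nets under completeness\<close>

lemma nondecreasing_net_converges:
  assumes mcomplete and net: "nondecreasing_net (\<le>\<^sub>S) D r x"
    and le: "\<And>n. n \<in> D \<Longrightarrow> N (delta (x n)) \<le> C"
  shows "net_converges mtopology D r x"
proof (rule monotone_potential_net_converges[where g = "\<lambda>n. N (delta (x n)) / 2"])
  show "bdd_above ((\<lambda>n. N (delta (x n)) / 2) ` D)"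
    using le by (intro bdd_aboveI2[of _ _ "C / 2"]) simp
qed (use assms in \<open>auto simp: nondecreasing_net_def norm_dist_nat_le diff_divide_distrib\<close>)

lemma nonincreasing_net_converges:
  assumes mcomplete and net: "nonincreasing_net (\<le>\<^sub>S) D r x"
  shows "net_converges mtopology D r x"
proof (rule monotone_potential_net_converges[where g = "\<lambda>n. - N (delta (x n)) / 2"])
  \<comment> \<open>With the sign reversed the potential increases along the net, and nonnegativity
    of the norm bounds it by 0.\<close>
  show "bdd_above ((\<lambda>n. - N (delta (x n)) / 2) ` D)"
    by (intro bdd_aboveI2[of _ _ 0]) simp
  fix m n assume "m \<in> D" "n \<in> D" "r m n"
  then have "x n \<le>\<^sub>S x m"
    using net by (simp add: nonincreasing_net_def)
  then show "norm_dist N (x m) (x n) \<le> - N (delta (x n)) / 2 - - N (delta (x m)) / 2"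
    using norm_dist_nat_le norm_dist_commute[of "x m"] by (simp add: diff_divide_distrib)
qed (use assms in \<open>auto simp: nonincreasing_net_def\<close>)

text \<open>Along a nonincreasing net the norms grow towards early indices, which a bound on a tail
  does not reach; a first index makes the whole of \<open>D\<close> one tail.\<close>

lemma monotone_net_bounded:
  assumes "monotone_net (\<le>\<^sub>S) D r x" "nondecreasing_net (\<le>\<^sub>S) D r x \<or> has_first_index D r"
    "eventually_bounded_net D r (\<lambda>n. N (x n))"
  shows "bounded_net D (\<lambda>n. N (x n))"
proof (cases "nondecreasing_net (\<le>\<^sub>S) D r x")
  case True
  then show ?thesis
    using assms(3) by (rule nondecreasing_net_bounded)
next
  case False
  then obtain m where m: "m \<in> D" "\<forall>n\<in>D. r m n"
    using assms(2) by (auto simp: has_first_index_def)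
  then have "{n\<in>D. r m n} = D"
    by blast
  then show ?thesis
    using nonincreasing_net_bounded[of D r x m] assms(1) False m(1)
    by (simp add: monotone_net_def bounded_net_def)
qed

lemma bounded_net_imp_eventually_bounded:
  assumes "directed_set D r" "bounded_net D f"
  shows "eventually_bounded_net D r f"
proof -
  obtain m where "m \<in> D"
    using assms(1) by (auto simp: directed_set_def)
  moreover have "bounded (f ` {n\<in>D. r m n})"
    using assms(2) unfolding bounded_net_def by (rule bounded_subset) auto
  ultimately show ?thesis
    unfolding eventually_bounded_net_def by blast
qed

lemma monotone_net_directed: "monotone_net (\<le>\<^sub>S) D r x \<Longrightarrow> directed_set D r"
  by (auto simp: monotone_net_def nondecreasing_net_def nonincreasing_net_def)

lemma monotone_net_converges_iff:
  assumes complete: mcomplete and net: "monotone_net (\<le>\<^sub>S) D r x"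
  shows "net_converges mtopology D r x \<longleftrightarrow> eventually_bounded_net D r (\<lambda>n. N (x n))"
proof
  assume bdd: "eventually_bounded_net D r (\<lambda>n. N (x n))"
  show "net_converges mtopology D r x"
  proof (cases "nondecreasing_net (\<le>\<^sub>S) D r x")
    case True
    obtain C where C: "\<forall>n\<in>D. norm (N (x n)) \<le> C"
      using nondecreasing_net_bounded[OF True bdd] unfolding bounded_net_def bounded_iff by blast
    have "N (delta (x n)) \<le> C" if "n \<in> D" for n
      using bspec[OF C that] norm_delta_le[of "x n"] by simp
    then show ?thesis
      by (rule nondecreasing_net_converges[OF complete True])
  next
    case False
    then show ?thesis
      using net nonincreasing_net_converges[OF complete] by (auto simp: monotone_net_def)
  qed
qed (rule convergent_net_eventually_bounded[OF monotone_net_directed[OF net]])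

section \<open>Conditional completeness and compatibility of the order\<close>

lemma nondecreasing_net_limit:
  assumes complete: mcomplete and net: "nondecreasing_net (\<le>\<^sub>S) D r x"
    and u: "is_upper (\<le>\<^sub>S) (x ` D) u"
  obtains l where "net_limit mtopology D r x l" "is_supremum (\<le>\<^sub>S) (x ` D) l"
proof -
  \<comment> \<open>An order bound becomes a norm bound, which supplies the bounded
    potential.\<close>
  have "N (delta (x n)) \<le> N (delta u)" if "n \<in> D" for n
    using u that by (simp add: is_upper_def norm_delta_mono)
  then obtain l where "net_limit mtopology D r x l"
    using nondecreasing_net_converges[OF complete net] by (auto simp: net_converges_def)
  then show thesis
    using that nondecreasing_net_limit_supremum[OF net] by blast
qed

lemma nonincreasing_net_limit:
  assumes complete: mcomplete and net: "nonincreasing_net (\<le>\<^sub>S) D r x"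
  obtains l where "net_limit mtopology D r x l" "is_infimum (\<le>\<^sub>S) (x ` D) l"
  using nonincreasing_net_converges[OF assms] nonincreasing_net_limit_infimum[OF net]
  by (auto simp: net_converges_def)

lemma conditionally_monotone_complete_nat_le:
  assumes mcomplete
  shows "conditionally_monotone_complete TYPE('i) ((\<le>\<^sub>S) :: 'a \<Rightarrow> 'a \<Rightarrow> bool)"
  unfolding conditionally_monotone_complete_def
proof (intro allI impI)
  fix D :: "'i set" and r and x :: "'i \<Rightarrow> 'a"
  assume *: "monotone_net (\<le>\<^sub>S) D r x \<and> order_bounded (\<le>\<^sub>S) (x ` D)"
  then obtain u where u: "is_upper (\<le>\<^sub>S) (x ` D) u"
    by (auto simp: order_bounded_def)
  from * show "\<exists>s. is_supinf (\<le>\<^sub>S) D r x s"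
    unfolding monotone_net_def is_supinf_def
    by (meson u nondecreasing_net_limit[OF assms] nonincreasing_net_limit[OF assms])
qed

lemma is_supremum_unique:
  "is_supremum (\<le>\<^sub>S) A s \<Longrightarrow> is_supremum (\<le>\<^sub>S) A t \<Longrightarrow> s = (t :: 'a)"
  unfolding is_supremum_def by (meson nat_le_antisym)

lemma is_infimum_unique:
  "is_infimum (\<le>\<^sub>S) A s \<Longrightarrow> is_infimum (\<le>\<^sub>S) A t \<Longrightarrow> s = (t :: 'a)"
  unfolding is_infimum_def by (meson nat_le_antisym)

text \<open>Completeness provides some limit, which is itself a supremum or infimum of the net;
  antisymmetry identifies it with \<open>s\<close>. In the nondecreasing case \<open>s\<close> is
  also the upper bound that ensures convergence.\<close>

lemma compatible_topology_nat_le: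
  assumes mcomplete
  shows "compatible_topology TYPE('i) mtopology (\<le>\<^sub>S)"
  unfolding compatible_topology_def is_supinf_def
proof (intro allI impI, elim conjE disjE)
  fix D :: "'i set" and r and x :: "'i \<Rightarrow> 'a" and s
  assume net: "nondecreasing_net (\<le>\<^sub>S) D r x" and sup: "is_supremum (\<le>\<^sub>S) (x ` D) s"
  then have "is_upper (\<le>\<^sub>S) (x ` D) s"
    by (simp add: is_supremum_def)
  then obtain l where "net_limit mtopology D r x l" "is_supremum (\<le>\<^sub>S) (x ` D) l"
    by (rule nondecreasing_net_limit[OF assms net])
  then show "net_limit mtopology D r x s"
    using is_supremum_unique[OF sup] by simp
next
  fix D :: "'i set" and r and x :: "'i \<Rightarrow> 'a" and s
  assume net: "nonincreasing_net (\<le>\<^sub>S) D r x" and inf: "is_infimum (\<le>\<^sub>S) (x ` D) s"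
  obtain l where "net_limit mtopology D r x l" "is_infimum (\<le>\<^sub>S) (x ` D) l"
    by (rule nonincreasing_net_limit[OF assms net])
  then show "net_limit mtopology D r x s"
    using is_infimum_unique[OF inf] by simp
qed

end

section \<open>The norm of a metric\<close>

locale clifford_metric = clifford_monoid S + Metric_space UNIV d
  for S :: "'a::inverse_monoid_add itself" and d :: "'a \<Rightarrow> 'a \<Rightarrow> real" +
  assumes subinvariant: "right_subinvariant d" and skew: "skew_convex d"
begin

definition metric_norm :: "'a \<Rightarrow> real" where
  "metric_norm x = d x 0 + d (delta x) 0"

text \<open>Half the norm of the idempotent \<open>delta x\<close>. Distances between comparable
  idempotents are differences of this function.\<close>

definition height :: "'a \<Rightarrow> real" where
  "height x = d 0 (delta x)"

text \<open>Translating by \<open>y\<close> inside the maximal subgroup at \<open>delta x + delta y\<close> turns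
  \<open>d (delta x + delta y) (x + y\<^sup>\<star>)\<close> into this symmetric expression.\<close>

definition cross_dist :: "'a \<Rightarrow> 'a \<Rightarrow> real" where
  "cross_dist x y = d (x + delta y) (y + delta x)"

lemma height_delta [simp]: "height (delta x) = height x"
  by (simp add: height_def)

lemma height_cong: "delta x = delta y \<Longrightarrow> height x = height y"
  by (simp add: height_def)

section \<open>Heights and distances between idempotents\<close>

lemma dist_add_right: "d (x + y) (z + y) \<le> d x z"
  using subinvariant unfolding right_subinvariant_def by (metis star_star)

lemma dist_delta: "d (delta x) (delta y) \<le> d x y"
  using skew by (simp add: skew_convex_def)

lemma dist_split:
  assumes "delta x + delta y = delta y" "delta y + delta z = delta z"
  shows "d x z = d (delta x) (delta y) + d (x + y\<^sup>\<star>) (z + y\<^sup>\<star>)"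
  using skew assms by (simp add: skew_convex_def nat_le_delta_iff)

text \<open>Skew-convexity splits the distance from 0 to \<open>delta y\<close> at the intermediate
  idempotent \<open>delta x\<close>.\<close>

lemma dist_deltas:
  assumes "delta x + delta y = delta y"
  shows "d (delta x) (delta y) = height y - height x"
  using dist_split[of 0 "delta x" "delta y"] assms delta_central[of x "delta y"]
  by (simp add: height_def)

lemma height_add: "height x \<le> height (x + y)"
  using dist_deltas[of x "x + y"] nonneg[of "delta x" "delta (x + y)"] by (simp add: delta_add)

lemma dist_zero: "d 0 x = height x + d (delta x) x"
  using dist_split[of 0 "delta x" x] by (simp add: height_def)

lemma metric_norm_eq: "metric_norm x = 2 * height x + d (delta x) x"
  using dist_zero[of x] commute[of 0 x] commute[of 0 "delta x"]
  by (simp add: metric_norm_def height_def)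

lemma metric_norm_delta: "metric_norm (delta x) = 2 * height x"
  by (simp add: metric_norm_eq)

text \<open>Split at \<open>delta x + delta y\<close>: translation by this idempotent sends both
  endpoints to \<open>x + delta y\<close>, so only the distance between idempotents
  survives.\<close>

lemma dist_add_delta: "d x (x + delta y) = height (x + y) - height x"
proof -
  have x: "x + (delta x + delta y) = x + delta y"
    by (simp flip: add.assoc)
  have y: "x + delta y + (delta x + delta y) = x + delta y"
    by (metis delta_add delta_delta delta_right)
  have "(delta x + delta y)\<^sup>\<star> = delta x + delta y"
    and "delta x + delta y + (delta x + delta y) = delta x + delta y"
    by (metis delta_add star_delta, metis delta_add delta_idem)
  then show ?thesis
    using dist_split[of x "delta x + delta y" "x + delta y"] dist_deltas[of x "x + y"]
    by (simp add: delta_add x y)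
qed

text \<open>Translation by \<open>delta x\<close> contracts the step from \<open>delta z\<close> to
  \<open>delta (y + z)\<close>, and both the step and its image are measured by height
  increments.\<close>

lemma height_submodular: "height (x + y + z) + height z \<le> height (x + z) + height (y + z)"
proof -
  have eq: "delta z + delta x = delta (x + z)" "delta (y + z) + delta x = delta (x + y + z)"
    by (simp_all add: delta_add delta_central[of x] add.assoc)
  have "d (delta (x + z)) (delta (x + y + z)) \<le> d (delta z) (delta (y + z))"
    using dist_add_right[of "delta z" "delta x" "delta (y + z)"] eq by simp
  moreover have "d (delta z) (delta (y + z)) = height (y + z) - height z"
  proof (rule dist_deltas)
    show "delta z + delta (y + z) = delta (y + z)"
      by (simp add: delta_add delta_central[of y "delta z"])
  qed
  moreover have "d (delta (x + z)) (delta (x + y + z)) = height (x + y + z) - height (x + z)"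
  proof (rule dist_deltas)
    have "delta (x + y + z) = delta (x + z) + delta y"
      by (simp add: delta_add add.assoc delta_central[of y])
    then show "delta (x + z) + delta (x + y + z) = delta (x + y + z)"
      by simp
  qed
  ultimately show ?thesis
    by linarith
qed

text \<open>Translation by \<open>y\<^sup>\<star>\<close> takes \<open>x + delta y\<close> and
  \<open>y + delta x\<close> to \<open>x + y\<^sup>\<star>\<close> and \<open>?e\<close>, and
  translation by \<open>y\<close> takes them back. Both contract, so the two distances
  agree.\<close>

lemma metric_norm_add_star: "metric_norm (x + y\<^sup>\<star>) = 2 * height (x + y) + cross_dist x y"
proof -
  let ?e = "delta x + delta y"
  have "x + delta y + y\<^sup>\<star> = x + y\<^sup>\<star>"
    by (metis add.assoc delta_left delta_star)
  moreover have "y + delta x + y\<^sup>\<star> = ?e"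
    by (metis add.assoc delta_central delta_eq(1))
  ultimately have "d (x + y\<^sup>\<star>) ?e \<le> cross_dist x y"
    using dist_add_right[of "x + delta y" "y\<^sup>\<star>" "y + delta x"] by (simp add: cross_dist_def)
  moreover have "cross_dist x y \<le> d (x + y\<^sup>\<star>) ?e"
    using dist_add_right[of "x + y\<^sup>\<star>" y ?e] delta_central[of x y]
    by (simp add: cross_dist_def add.assoc)
  ultimately show ?thesis
    using commute[of ?e] height_cong[of "x + y\<^sup>\<star>" "x + y"]
    by (simp add: metric_norm_eq delta_add)
qed

section \<open>The norm axioms\<close>

lemma cross_dist_nonneg: "0 \<le> cross_dist x y"
  by (simp add: cross_dist_def)

lemma cross_dist_commute: "cross_dist x y = cross_dist y x"
  by (simp add: cross_dist_def commute)

lemma height_commute: "height (x + y) = height (y + x)"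
  by (rule height_cong) (simp add: delta_add delta_central[of x])

text \<open>All three elements are moved to the maximal subgroup at
  \<open>delta x + delta y + delta z\<close>, where the ordinary triangle inequality applies. Moving
  the endpoints there costs one height increment each, while the distances to \<open>z\<close> only
  shrink.\<close>

lemma cross_dist_triangle:
  "cross_dist x y \<le> 2 * (height (x + y + z) - height (x + y)) + cross_dist x z + cross_dist z y"
proof -
  let ?x = "x + delta y + delta z" and ?y = "y + delta x + delta z"
    and ?z = "z + delta x + delta y"
  have "d (x + delta y) ?x = height (x + y + z) - height (x + y)"
    unfolding dist_add_delta
    by (intro arg_cong2[where f = "(-)"] height_cong) (simp_all add: delta_add)
  moreover have "d (y + delta x) ?y = height (x + y + z) - height (x + y)"
    unfolding dist_add_delta
    by (intro arg_cong2[where f = "(-)"] height_cong) (simp_all add: delta_add delta_central[of x])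
  moreover have "d ?x ?z \<le> cross_dist x z"
    using dist_add_right[of "x + delta z" "delta y" "z + delta x"] delta_central[of y "delta z"]
    by (simp add: cross_dist_def add.assoc)
  moreover have "d ?z ?y \<le> cross_dist z y"
    using dist_add_right[of "z + delta y" "delta x" "y + delta z"] delta_central[of x "delta y"]
      delta_central[of x "delta z"]
    by (simp add: cross_dist_def add.assoc)
  moreover have "cross_dist x y \<le> d (x + delta y) ?x + (d ?x ?z + d ?z ?y) + d (y + delta x) ?y"
    using triangle[of "x + delta y" ?x "y + delta x"] triangle'[of ?x ?y "y + delta x"]
      triangle[of ?x ?z ?y]
    by (simp add: cross_dist_def)
  ultimately have "cross_dist x y \<le> (height (x + y + z) - height (x + y))
      + (cross_dist x z + cross_dist z y) + (height (x + y + z) - height (x + y))"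
    by (smt (verit))
  then show ?thesis
    by simp
qed

lemma metric_norm_norm: "monoid_norm metric_norm"
  unfolding monoid_norm_def monoid_pseudo_norm_def pseudo_norm_def
proof (intro conjI allI ballI impI)
  fix x y z :: 'a
  show "0 \<le> metric_norm x"
    by (simp add: metric_norm_def)
  show "metric_norm (x + y\<^sup>\<star>) = metric_norm (y + x\<^sup>\<star>)"
    by (simp add: metric_norm_add_star height_commute[of x] cross_dist_commute[of x])
  show "metric_norm (x + x\<^sup>\<star>) \<le> metric_norm (x + y\<^sup>\<star>)"
    using height_add[of x y] cross_dist_nonneg[of x y]
    by (simp add: metric_norm_delta metric_norm_add_star)
  \<comment> \<open>The term \<open>2 * height (x + y)\<close> cancels against the cost in
    \<open>cross_dist_triangle\<close>; submodularity absorbs the remaining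
    \<open>2 * height (x + y + z)\<close>.\<close>
  show "metric_norm (x + y\<^sup>\<star>) + metric_norm (z + z\<^sup>\<star>)
      \<le> metric_norm (x + z\<^sup>\<star>) + metric_norm (z + y\<^sup>\<star>)"
    unfolding delta_eq metric_norm_delta metric_norm_add_star
    using cross_dist_triangle[of x y z] height_submodular[of x y z] height_commute[of y z]
    by (smt (verit))
  show "metric_norm 0 = 0"
    by (simp add: metric_norm_def)
next
  fix e x :: 'a
  assume e: "e \<in> idempotents" and x: "x \<in> local_submonoid e" and eq: "metric_norm x = metric_norm e"
  have de: "delta e = e"
    using e by (rule delta_of_idempotent)
  have "delta e + delta x = delta x"
    using x by (simp add: local_submonoid_def flip: delta_add)
  then have dist: "d (delta e) (delta x) = height x - height e"
    by (rule dist_deltas)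
  \<comment> \<open>Twice the height increment from \<open>e\<close> to \<open>x\<close> and the
    distance from \<open>delta x\<close> to \<open>x\<close> are nonnegative with sum 0, so
    \<open>x = delta x = e\<close>.\<close>
  have "2 * height x + d (delta x) x = 2 * height e"
    using eq metric_norm_delta[of e] by (simp add: de metric_norm_eq[of x])
  moreover have "0 \<le> d (delta e) (delta x)" "0 \<le> d (delta x) x"
    by simp_all
  ultimately have "d (delta e) (delta x) = 0" "d (delta x) x = 0"
    using dist by linarith+
  then show "x = e"
    by (simp add: de)
qed

section \<open>Comparison of the two distances and their topologies\<close>

lemma norm_dist_metric_norm:
  "norm_dist metric_norm x y = 2 * height (x + y) + cross_dist x y - height x - height y"
  by (simp add: norm_dist_def metric_norm_add_star metric_norm_delta add_divide_distrib)

text \<open>By \<open>dist_add_delta\<close>, the norm distance is the length of the path from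
  \<open>x\<close> through \<open>x + delta y\<close> and \<open>y + delta x\<close> to
  \<open>y\<close>.\<close>

lemma dist_le_norm_dist: "d x y \<le> norm_dist metric_norm x y"
proof -
  have "d x y \<le> d x (x + delta y) + cross_dist x y + d y (y + delta x)"
    using triangle[of x "x + delta y" y] triangle'[of "x + delta y" "y + delta x" y]
    by (simp add: cross_dist_def)
  then show ?thesis
    by (simp add: dist_add_delta norm_dist_metric_norm height_commute[of y])
qed

text \<open>Each of the three legs of that path is at most \<open>d x y\<close>: the outer two by
  translating idempotents and contracting under \<open>delta\<close>, the middle one by translating
  by \<open>delta x + delta y\<close>.\<close>

lemma norm_dist_le_dist: "norm_dist metric_norm x y \<le> 3 * d x y"
proof -
  have half: "height (x + y) - height x \<le> d x y" for x y
  proof -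
    have "height (x + y) - height x = d (delta x) (delta (x + y))"
      using dist_deltas[of x "x + y"] by (simp add: delta_add)
    also have "\<dots> \<le> d (delta x) (delta y)"
      using dist_add_right[of "delta x" "delta x" "delta y"] delta_central[of x "delta y"]
      by (simp add: delta_add)
    finally show ?thesis
      using dist_delta[of x y] by linarith
  qed
  have "x + delta y = x + (delta x + delta y)" "y + delta x = y + (delta x + delta y)"
    by (metis add.assoc delta_right, metis add.assoc delta_central delta_right)
  then have "cross_dist x y \<le> d x y"
    using dist_add_right[of x "delta x + delta y" y] by (simp add: cross_dist_def)
  then show ?thesis
    using half[of x y] half[of y x] commute[of x y] height_commute[of x y]
    by (simp add: norm_dist_metric_norm)
qed

lemma mtopology_eq_norm_topology: "mtopology = norm_topology metric_norm"
proof -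
  interpret n: clifford_norm S metric_norm
    by unfold_locales (rule metric_norm_norm)
  have "openin mtopology U \<longleftrightarrow> openin n.mtopology U" for U
  proof
    assume U: "openin mtopology U"
    show "openin n.mtopology U"
      unfolding n.openin_mtopology
    proof (intro conjI allI impI)
      fix x assume "x \<in> U"
      then obtain \<epsilon> where "\<epsilon> > 0" "mball x \<epsilon> \<subseteq> U"
        using U by (auto simp: openin_mtopology)
      moreover have "n.mball x \<epsilon> \<subseteq> mball x \<epsilon>"
        using dist_le_norm_dist le_less_trans by fastforce
      ultimately show "\<exists>\<epsilon>>0. n.mball x \<epsilon> \<subseteq> U"
        by blast
    qed simp
  next
    assume U: "openin n.mtopology U"
    show "openin mtopology U"
      unfolding openin_mtopology
    proof (intro conjI allI impI)
      fix x assume "x \<in> U"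
      then obtain \<epsilon> where \<epsilon>: "\<epsilon> > 0" "n.mball x \<epsilon> \<subseteq> U"
        using U by (auto simp: n.openin_mtopology)
      \<comment> \<open>The radius reflects the factor 3 in
        \<open>norm_dist_le_dist\<close>.\<close>
      have "mball x (\<epsilon> / 3) \<subseteq> n.mball x \<epsilon>"
      proof
        fix y assume "y \<in> mball x (\<epsilon> / 3)"
        then show "y \<in> n.mball x \<epsilon>"
          using norm_dist_le_dist[of x y] by simp
      qed
      then show "\<exists>\<epsilon>>0. mball x \<epsilon> \<subseteq> U"
        using \<epsilon> by (intro exI[of _ "\<epsilon> / 3"]) auto
    qed simp
  qed
  then show ?thesis
    by (simp add: norm_topology_def topology_eq)
qed

end

text \<open>Bounded norms make a monotone net Cauchy, and completeness turns this into convergence,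
  so that implication is stated under \<open>mcomplete\<close>. Convergence controls a tail; for
  nondecreasing nets or in the presence of a first index, this extends to the whole net.\<close>

theorem mainTheorem1:
  assumes clifford: "\<And>x :: 'a::inverse_monoid_add. x + x\<^sup>\<star> = x\<^sup>\<star> + x"
  shows
    "(\<forall>nrm :: 'a \<Rightarrow> real. monoid_norm nrm \<longrightarrow>
        (let d = (\<lambda>x y. nrm (x + y\<^sup>\<star>) - (nrm (x + x\<^sup>\<star>) + nrm (y + y\<^sup>\<star>)) / 2);
             T = Metric_space.mtopology UNIV d in
           Metric_space UNIV d \<and> right_subinvariant d \<and> skew_convex d \<and>
           (cyclically_permutable nrm \<longrightarrow>
              Hausdorff_space T \<and> topological_inverse_semigroup T \<and>
              (\<forall>(D :: 'i set) r x. monotone_net (\<le>\<^sub>S) D r x \<longrightarrow>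
                 (net_converges T D r x \<longrightarrow> eventually_bounded_net D r (\<lambda>n. nrm (x n))) \<and>
                 (nondecreasing_net (\<le>\<^sub>S) D r x \<or> has_first_index D r \<longrightarrow>
                    net_converges T D r x \<longrightarrow> bounded_net D (\<lambda>n. nrm (x n))) \<and>
                 (Metric_space.mcomplete UNIV d \<longrightarrow>
                    (net_converges T D r x \<longleftrightarrow> eventually_bounded_net D r (\<lambda>n. nrm (x n))) \<and>
                    (nondecreasing_net (\<le>\<^sub>S) D r x \<or> has_first_index D r \<longrightarrow>
                       (net_converges T D r x \<longleftrightarrow> bounded_net D (\<lambda>n. nrm (x n))))))) \<and>
           (Metric_space.mcomplete UNIV d \<longrightarrow>
              conditionally_monotone_complete TYPE('i) ((\<le>\<^sub>S) :: 'a \<Rightarrow> 'a \<Rightarrow> bool) \<and>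
              compatible_topology TYPE('i) T (\<le>\<^sub>S))))
     \<and>
     (\<forall>d :: 'a \<Rightarrow> 'a \<Rightarrow> real.
        Metric_space UNIV d \<and> right_subinvariant d \<and> skew_convex d \<longrightarrow>
        (let nrm = (\<lambda>x. d x 0 + d (x + x\<^sup>\<star>) 0) in
           monoid_norm nrm \<and>
           Metric_space.mtopology UNIV d = norm_topology nrm))"
proof (intro conjI allI impI)
  fix nrm :: "'a \<Rightarrow> real"
  assume nrm: "monoid_norm nrm"
  interpret clifford_norm "TYPE('a)" nrm
    by unfold_locales (use clifford nrm in auto)
  have dist: "(\<lambda>x y. nrm (x + y\<^sup>\<star>) - (nrm (x + x\<^sup>\<star>) + nrm (y + y\<^sup>\<star>)) / 2) = norm_dist nrm"
    by (simp add: fun_eq_iff norm_dist_def)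
  have nets: "(net_converges mtopology D r x \<longrightarrow> eventually_bounded_net D r (\<lambda>n. nrm (x n))) \<and>
      (nondecreasing_net (\<le>\<^sub>S) D r x \<or> has_first_index D r \<longrightarrow>
         net_converges mtopology D r x \<longrightarrow> bounded_net D (\<lambda>n. nrm (x n))) \<and>
      (mcomplete \<longrightarrow>
         (net_converges mtopology D r x \<longleftrightarrow> eventually_bounded_net D r (\<lambda>n. nrm (x n))) \<and>
         (nondecreasing_net (\<le>\<^sub>S) D r x \<or> has_first_index D r \<longrightarrow>
            (net_converges mtopology D r x \<longleftrightarrow> bounded_net D (\<lambda>n. nrm (x n)))))"
    if net: "monotone_net (\<le>\<^sub>S) D r x" for D :: "'i set" and r x
  proof -
    note D = monotone_net_directed[OF net]
    have "net_converges mtopology D r x \<Longrightarrow> eventually_bounded_net D r (\<lambda>n. nrm (x n))"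
      by (rule convergent_net_eventually_bounded[OF D])
    moreover have "mcomplete \<Longrightarrow>
        net_converges mtopology D r x \<longleftrightarrow> eventually_bounded_net D r (\<lambda>n. nrm (x n))"
      using net by (rule monotone_net_converges_iff[rotated])
    \<comment> \<open>This carries the statements about tails over to literal boundedness.\<close>
    moreover have "nondecreasing_net (\<le>\<^sub>S) D r x \<or> has_first_index D r \<Longrightarrow>
        eventually_bounded_net D r (\<lambda>n. nrm (x n)) \<longleftrightarrow> bounded_net D (\<lambda>n. nrm (x n))"
      using monotone_net_bounded[OF net] bounded_net_imp_eventually_bounded[OF D] by blast
    ultimately show ?thesis
      by blast
  qed
  show "let d = (\<lambda>x y. nrm (x + y\<^sup>\<star>) - (nrm (x + x\<^sup>\<star>) + nrm (y + y\<^sup>\<star>)) / 2);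
             T = Metric_space.mtopology UNIV d in
           Metric_space UNIV d \<and> right_subinvariant d \<and> skew_convex d \<and>
           (cyclically_permutable nrm \<longrightarrow>
              Hausdorff_space T \<and> topological_inverse_semigroup T \<and>
              (\<forall>(D :: 'i set) r x. monotone_net (\<le>\<^sub>S) D r x \<longrightarrow>
                 (net_converges T D r x \<longrightarrow> eventually_bounded_net D r (\<lambda>n. nrm (x n))) \<and>
                 (nondecreasing_net (\<le>\<^sub>S) D r x \<or> has_first_index D r \<longrightarrow>
                    net_converges T D r x \<longrightarrow> bounded_net D (\<lambda>n. nrm (x n))) \<and>
                 (Metric_space.mcomplete UNIV d \<longrightarrow>
                    (net_converges T D r x \<longleftrightarrow> eventually_bounded_net D r (\<lambda>n. nrm (x n))) \<and>
                    (nondecreasing_net (\<le>\<^sub>S) D r x \<or> has_first_index D r \<longrightarrow>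
                       (net_converges T D r x \<longleftrightarrow> bounded_net D (\<lambda>n. nrm (x n))))))) \<and>
           (Metric_space.mcomplete UNIV d \<longrightarrow>
              conditionally_monotone_complete TYPE('i) ((\<le>\<^sub>S) :: 'a \<Rightarrow> 'a \<Rightarrow> bool) \<and>
              compatible_topology TYPE('i) T (\<le>\<^sub>S))"
    unfolding dist Let_def
    by (intro conjI impI allI Metric_space_axioms right_subinvariant_norm_dist
        skew_convex_norm_dist Hausdorff_space_mtopology topological_inverse_semigroup_norm
        conditionally_monotone_complete_nat_le compatible_topology_nat_le nets[rule_format])
next
  fix d :: "'a \<Rightarrow> 'a \<Rightarrow> real"
  assume d: "Metric_space UNIV d \<and> right_subinvariant d \<and> skew_convex d"
  then interpret Metric_space UNIV d
    by simp
  interpret clifford_metric "TYPE('a)" d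
    by unfold_locales (use clifford d in auto)
  have "(\<lambda>x. d x 0 + d (x + x\<^sup>\<star>) 0) = metric_norm"
    by (simp add: fun_eq_iff metric_norm_def)
  then show "let nrm = (\<lambda>x. d x 0 + d (x + x\<^sup>\<star>) 0) in
      monoid_norm nrm \<and> Metric_space.mtopology UNIV d = norm_topology nrm"
    using metric_norm_norm mtopology_eq_norm_topology by (simp add: Let_def)
qed

end
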